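(* Let $\pi=(d_0,d_1,\dots,d_{n-1})$ be a graphic unicyclic degree sequence with $3\le d_0\le\cdots\le d_k$ and $d_{k+1}=\cdots=d_{n-1}=1$. Let $G=(V_0\cup\partial V,E_0\cup\partial E)$ be a graph with the Faber-Krahn property in $\mathcal{U}_\pi$, and let $f$ be the first eigenfunction of $G$. Then $G$ has an SLO-ordering $\prec$ (with respect to some root $v_0\in V(G)$) such that, for all vertices $u,v$ of $G$, $v\prec u$ implies $f(v)\ge f(u)$.
   Context: All graphs are finite, simple and undirected. A connected graph is unicyclic if its number of vertices equals its number of edges (so it contains exactly one cycle). A positive integer sequence $\pi=(d_0,\dots,d_{n-1})$ is a graphic unicyclic degree sequence if some unicyclic graph has degree sequence $\pi$ (up to order); $\mathcal{U}_\pi$ is the set of all unicyclic graphs with degree sequence $\pi$. Every graph $G$ is regarded as a graph with boundary $G=(V_0\cup\partial V,E_0\cup\partial E)$: the boundary vertices $\partial V$ are the vertices of degree $1$, the interior vertices $V_0$ are the vertices of degree at least $2$, interior edges $E_0$ join interior vertices, and boundary edges $\partial E$ join an interior vertex to a boundary vertex. $d(v)$ is the degree of $v$, and $L(G)=D(G)-A(G)$ is the Laplacian matrix (degree diagonal matrix minus adjacency matrix). A real number $\lambda$ is a Dirichlet eigenvalue of $G$ if there is a function $f\ne0$ on $V(G)$ with $(L(G)f)(u)=\lambda f(u)$ for $u\in V_0$ and $f(u)=0$ for $u\in\partial V$. The first (smallest) Dirichlet eigenvalue is $\lambda(G)=\min_f \frac{\sum_{uv\in E(G)}(f(u)-f(v))^2}{\sum_{v\in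 V(G)}f(v)^2}$, the minimum being over nonzero real functions $f$ on $V(G)$ with $f|_{\partial V}=0$. For connected $G$ it is a simple eigenvalue, and the first eigenfunction of $G$ is its unique eigenfunction $f$ with $f>0$ on $V_0$, $f=0$ on $\partial V$ and $\|f\|=1$. A graph $G\in\mathcal{U}_\pi$ has the Faber-Krahn property in $\mathcal{U}_\pi$ if $\lambda(G)\le\lambda(H)$ for all $H\in\mathcal{U}_\pi$. SLO-ordering: let $G$ be a connected graph with boundary and with root $v_0$, and let $h(v)$ be the distance from $v$ to $v_0$. A well-ordering (strict linear order) $\prec$ of $V(G)$ is an SLO-ordering (spiral-like ordering) if for all $u,v,x,y\in V(G)$: (1) $v\prec u$ implies $h(v)\le h(u)$; (2) if $uv,xy\in E(G)$, $uy,xv\notin E(G)$, $h(u)=h(v)-1$, $h(x)=h(y)-1$ and $u\prec x$, then $v\prec y$; (3) if $v\prec u$ and $v\in\partial V$, then $u\in\partial V$. *)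

theory Defs
  imports Complex_Main "HOL-Library.Multiset" "Graph_Theory.Graph_Theory"
begin

text \<open>
  A finite simple undirected graph is a \<open>pair_graph\<close>: each undirected edge \<open>uv\<close> is
  represented by the two arcs \<open>(u,v)\<close> and \<open>(v,u)\<close>. Consequently the degree of a vertex is
  its \<open>out_degree\<close>, and \<open>uv\<close> is an edge iff \<open>(u,v) \<in> parcs G\<close>.
\<close>

definition edge_set :: "'a pair_pre_digraph \<Rightarrow> 'a set set" where
  "edge_set G = {{u, v} | u v. (u, v) \<in> parcs G}"

definition unicyclic :: "'a pair_pre_digraph \<Rightarrow> bool" where
  "unicyclic G \<longleftrightarrow>
     pair_graph G \<and> connected (with_proj G) \<and> card (pverts G) = card (edge_set G)"

definition degree_multiset :: "'a pair_pre_digraph \<Rightarrow> nat multiset" where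
  "degree_multiset G = image_mset (out_degree (with_proj G)) (mset_set (pverts G))"

text \<open>
  All graphs in \<open>unicyclic_class \<pi>\<close> have their vertices in the type \<open>'a\<close>. As they all have
  \<open>length \<pi>\<close> vertices, as soon as the class contains one graph it contains an isomorphic
  copy of every unicyclic graph with degree sequence \<open>\<pi>\<close>.
\<close>

definition unicyclic_class :: "nat list \<Rightarrow> 'a pair_pre_digraph set" where
  "unicyclic_class \<pi> = {G. unicyclic G \<and> degree_multiset G = mset \<pi>}"

definition graphic_unicyclic :: "nat list \<Rightarrow> bool" where
  "graphic_unicyclic \<pi> \<longleftrightarrow>
     (\<forall>d \<in> set \<pi>. 0 < d) \<and> (\<exists>G :: nat pair_pre_digraph. G \<in> unicyclic_class \<pi>)"

definition boundary_vertices :: "'a pair_pre_digraph \<Rightarrow> 'a set" where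
  "boundary_vertices G = {v \<in> pverts G. out_degree (with_proj G) v = 1}"

definition interior_vertices :: "'a pair_pre_digraph \<Rightarrow> 'a set" where
  "interior_vertices G = {v \<in> pverts G. 2 \<le> out_degree (with_proj G) v}"

definition laplacian :: "'a pair_pre_digraph \<Rightarrow> 'a \<Rightarrow> 'a \<Rightarrow> real" where
  "laplacian G u v =
     (if u = v then real (out_degree (with_proj G) u) else 0)
       - (if (u, v) \<in> parcs G then 1 else 0)"

definition laplacian_apply :: "'a pair_pre_digraph \<Rightarrow> ('a \<Rightarrow> real) \<Rightarrow> 'a \<Rightarrow> real" where
  "laplacian_apply G f u = (\<Sum>v\<in>pverts G. laplacian G u v * f v)"

text \<open>
  A function on \<open>V(G)\<close> is given by a function on the whole type \<open>'a\<close>; its values outside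
  \<open>pverts G\<close> never matter.
\<close>

definition dirichlet_function :: "'a pair_pre_digraph \<Rightarrow> ('a \<Rightarrow> real) \<Rightarrow> bool" where
  "dirichlet_function G f \<longleftrightarrow>
     (\<exists>v \<in> pverts G. f v \<noteq> 0) \<and> (\<forall>v \<in> boundary_vertices G. f v = 0)"

definition dirichlet_eigenfunction ::
    "'a pair_pre_digraph \<Rightarrow> real \<Rightarrow> ('a \<Rightarrow> real) \<Rightarrow> bool" where
  "dirichlet_eigenfunction G l f \<longleftrightarrow>
     dirichlet_function G f \<and>
     (\<forall>u \<in> interior_vertices G. laplacian_apply G f u = l * f u)"

text \<open>The factor \<open>1/2\<close> accounts for each edge contributing two arcs.\<close>

definition rayleigh_quotient :: "'a pair_pre_digraph \<Rightarrow> ('a \<Rightarrow> real) \<Rightarrow> real" where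
  "rayleigh_quotient G f =
     ((\<Sum>(u, v)\<in>parcs G. (f u - f v)\<^sup>2) / 2) / (\<Sum>v\<in>pverts G. (f v)\<^sup>2)"

text \<open>
  For a finite graph with an interior vertex this infimum is attained (compactness of the
  unit sphere), so it is the minimum.
\<close>

definition first_dirichlet_eigenvalue :: "'a pair_pre_digraph \<Rightarrow> real" where
  "first_dirichlet_eigenvalue G = (INF f \<in> {f. dirichlet_function G f}. rayleigh_quotient G f)"

definition first_eigenfunction :: "'a pair_pre_digraph \<Rightarrow> ('a \<Rightarrow> real) \<Rightarrow> bool" where
  "first_eigenfunction G f \<longleftrightarrow>
     dirichlet_eigenfunction G (first_dirichlet_eigenvalue G) f \<and>
     (\<forall>v \<in> interior_vertices G. 0 < f v) \<and>
     (\<forall>v \<in> boundary_vertices G. f v = 0) \<and>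
     sqrt (\<Sum>v\<in>pverts G. (f v)\<^sup>2) = 1"

definition faber_krahn :: "nat list \<Rightarrow> 'a pair_pre_digraph \<Rightarrow> bool" where
  "faber_krahn \<pi> G \<longleftrightarrow>
     G \<in> unicyclic_class \<pi> \<and>
     (\<forall>H \<in> (unicyclic_class \<pi> :: 'a pair_pre_digraph set).
        first_dirichlet_eigenvalue G \<le> first_dirichlet_eigenvalue H)"

definition hop_dist :: "'a pair_pre_digraph \<Rightarrow> 'a \<Rightarrow> 'a \<Rightarrow> nat" where
  "hop_dist G u v = (LEAST n. \<exists>p. pre_digraph.awalk (with_proj G) u p v \<and> length p = n)"

text \<open>
  The ordering is a relation \<open>R\<close> on \<open>V(G)\<close>, with \<open>(v,u) \<in> R\<close> for \<open>v \<prec> u\<close>. The condition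
  \<open>h(u) = h(v) - 1\<close> is written additively to avoid truncated subtraction.
\<close>

definition SLO_ordering :: "'a pair_pre_digraph \<Rightarrow> 'a \<Rightarrow> 'a rel \<Rightarrow> bool" where
  "SLO_ordering G v0 R \<longleftrightarrow>
     R \<subseteq> pverts G \<times> pverts G \<and> strict_linear_order_on (pverts G) R \<and> wf R \<and>
     (let h = hop_dist G v0 in
       (\<forall>v \<in> pverts G. \<forall>u \<in> pverts G. (v, u) \<in> R \<longrightarrow> h v \<le> h u) \<and>
       (\<forall>u \<in> pverts G. \<forall>v \<in> pverts G. \<forall>x \<in> pverts G. \<forall>y \<in> pverts G.
          (u, v) \<in> parcs G \<and> (x, y) \<in> parcs G \<and> (u, y) \<notin> parcs G \<and> (x, v) \<notin> parcs G \<and>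
          h u + 1 = h v \<and> h x + 1 = h y \<and> (u, x) \<in> R \<longrightarrow> (v, y) \<in> R) \<and>
       (\<forall>v \<in> pverts G. \<forall>u \<in> pverts G.
          (v, u) \<in> R \<and> v \<in> boundary_vertices G \<longrightarrow> u \<in> boundary_vertices G))"

end

theory Submission
  imports Defs
begin

text \<open>
  Switching edges \<open>uv\<close>, \<open>xy\<close> to \<open>uy\<close>, \<open>xv\<close> keeps all degrees and changes the energy of \<open>f\<close> by
  \<open>2 (f u - f x) (f v - f y)\<close>. Hence if the switched graph is still connected, minimality of \<open>G\<close>
  forces \<open>f v \<ge> f y\<close> whenever \<open>f u \<ge> f x\<close>. Root a breadth-first tree at a maximum point \<open>r\<close> of
  \<open>f\<close>; a single edge \<open>ab\<close> lies outside it. As \<open>r\<close> has degree at least 3, some child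
  of \<open>r\<close> is not above \<open>a\<close> or \<open>b\<close>, and switching along a path from it to a leaf against \<open>ab\<close> shows
  that \<open>r\<close>, \<open>a\<close>, \<open>b\<close> form a triangle. Further switchings show that \<open>f\<close> is smaller off this triangle
  than on it, strictly decreases from parents to children there, and that, for vertices off the
  triangle with distinct parents, the order of the \<open>f\<close>-values is inherited from the parents. So the
  order by level, then by parent, then by \<open>f\<close> among siblings is spiral-like and follows \<open>f\<close>.
\<close>

section \<open>Pair graphs, reachability and summation by parts\<close>

lemma pair_graph_iff:
  "pair_graph G \<longleftrightarrow>
     finite (pverts G) \<and> parcs G \<subseteq> pverts G \<times> pverts G \<and> sym (parcs G) \<and> irrefl (parcs G)"
proof
  assume "pair_graph G"
  then interpret pair_graph G .
  show "finite (pverts G) \<and> parcs G \<subseteq> pverts G \<times> pverts G \<and> sym (parcs G) \<and> irrefl (parcs G)"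
    using pair_finite_verts by (auto simp: sym_def irrefl_def dest: in_arcsD1 in_arcsD2 arcs_symmetric no_loops')
next
  assume *: "finite (pverts G) \<and> parcs G \<subseteq> pverts G \<times> pverts G \<and> sym (parcs G) \<and> irrefl (parcs G)"
  then have "finite (parcs G)"
    by (meson finite_SigmaI finite_subset)
  with * show "pair_graph G"
    by unfold_locales (auto simp: symmetric_def irrefl_def)
qed

text \<open>Symmetry of the arcs reduces connectivity to reachability in the plain relation
  \<open>parcs G\<close>. Deleting edges then becomes set difference under a closure.\<close>

lemma connected_iff_rtrancl:
  assumes "pair_graph G"
  shows "connected (with_proj G) \<longleftrightarrow>
           pverts G \<noteq> {} \<and> (\<forall>u \<in> pverts G. \<forall>v \<in> pverts G. (u, v) \<in> (parcs G)\<^sup>*)"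
proof -
  interpret pair_graph G by fact
  have "(parcs G)\<^sup>s = parcs G"
    using arcs_symmetric by (auto simp: symcl_def)
  moreover have "(u, v) \<in> rtrancl_on (pverts G) (parcs G) \<longleftrightarrow> (u, v) \<in> (parcs G)\<^sup>*"
    if "u \<in> pverts G" "v \<in> pverts G" for u v
    using that by (meson in_arcsD2 rtrancl_consistent_rtrancl_on rtrancl_on_rtranclI)
  ultimately show ?thesis
    by (simp add: connected_conv)
qed

lemma out_degree_with_proj: "out_degree (with_proj G) v = card {w. (v, w) \<in> parcs G}"
proof -
  have "out_arcs (with_proj G) v = Pair v ` {w. (v, w) \<in> parcs G}"
    by (auto simp: out_arcs_def)
  then show ?thesis
    by (simp add: out_degree_def card_image inj_on_def)
qed

lemma finite_parcs: "pair_graph G \<Longrightarrow> finite (parcs G)"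
  unfolding pair_graph_iff by (meson finite_SigmaI finite_subset)

lemma sum_parcs:
  assumes "pair_graph G"
  shows "(\<Sum>(s, t)\<in>parcs G. \<phi> s t) = (\<Sum>s\<in>pverts G. \<Sum>t | (s, t) \<in> parcs G. \<phi> s t)"
proof -
  have fin: "finite (pverts G)" and sub: "parcs G \<subseteq> pverts G \<times> pverts G"
    using assms by (auto simp: pair_graph_iff)
  have "parcs G = Sigma (pverts G) (\<lambda>s. {t. (s, t) \<in> parcs G})"
    using sub by auto
  moreover have "finite {t. (s, t) \<in> parcs G}" for s
    by (rule finite_subset[OF _ fin]) (use sub in auto)
  ultimately show ?thesis
    using fin sum.Sigma[of "pverts G" "\<lambda>s. {t. (s, t) \<in> parcs G}" \<phi>] by simp
qed

lemma sum_parcs_swap: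
  assumes "pair_graph G"
  shows "(\<Sum>(s, t)\<in>parcs G. \<phi> s t) = (\<Sum>(s, t)\<in>parcs G. \<phi> t s)"
  by (rule sum.reindex_bij_witness[of _ prod.swap prod.swap])
     (use assms in \<open>auto simp: pair_graph_iff dest: symD\<close>)

lemma laplacian_apply_eq_sum_neighbours:
  assumes "pair_graph G" "s \<in> pverts G"
  shows "laplacian_apply G f s = (\<Sum>t | (s, t) \<in> parcs G. f s - f t)"
proof -
  let ?N = "{t. (s, t) \<in> parcs G}"
  have fin: "finite (pverts G)" and N: "?N \<subseteq> pverts G"
    using assms by (auto simp: pair_graph_iff)
  have "laplacian_apply G f s =
      (\<Sum>t\<in>pverts G. (if s = t then real (card ?N) * f s else 0) - (if t \<in> ?N then f t else 0))"
    unfolding laplacian_apply_def laplacian_def out_degree_with_proj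
    by (rule sum.cong) (auto simp: algebra_simps)
  also have "\<dots> = real (card ?N) * f s - (\<Sum>t\<in>?N. f t)"
    using fin N assms(2) by (simp add: sum_subtractf sum.If_cases Int_absorb1)
  finally show ?thesis
    by (simp add: sum_subtractf)
qed

text \<open>Summation by parts: the product splits into \<open>h s * (f s - f t)\<close> and the
  same term with the arc reversed. Both sums agree because every edge gives both arcs, whence the
  factor 2.\<close>

lemma green_formula:
  assumes "pair_graph G"
  shows "(\<Sum>(s, t)\<in>parcs G. (f s - f t) * (h s - h t)) = 2 * (\<Sum>s\<in>pverts G. h s * laplacian_apply G f s)"
proof -
  have "(\<Sum>(s, t)\<in>parcs G. (f s - f t) * (h s - h t)) =
      (\<Sum>(s, t)\<in>parcs G. h s * (f s - f t)) + (\<Sum>(s, t)\<in>parcs G. h t * (f t - f s))"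
    by (subst sum.distrib[symmetric], rule sum.cong) (auto simp: algebra_simps)
  also have "(\<Sum>(s, t)\<in>parcs G. h t * (f t - f s)) = (\<Sum>(s, t)\<in>parcs G. h s * (f s - f t))"
    by (rule sum_parcs_swap[OF assms])
  also have "(\<Sum>(s, t)\<in>parcs G. h s * (f s - f t)) = (\<Sum>s\<in>pverts G. h s * laplacian_apply G f s)"
    unfolding sum_parcs[OF assms] sum_distrib_left[symmetric]
    by (intro sum.cong) (simp_all add: laplacian_apply_eq_sum_neighbours[OF assms])
  finally show ?thesis by simp
qed

lemma doubleton_in_edge_set_iff:
  "pair_graph G \<Longrightarrow> {s, t} \<in> edge_set G \<longleftrightarrow> (s, t) \<in> parcs G"
  by (auto simp: edge_set_def doubleton_eq_iff pair_graph_iff dest: symD)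

section \<open>Switching two edges\<close>

definition switch :: "'a pair_pre_digraph \<Rightarrow> 'a \<Rightarrow> 'a \<Rightarrow> 'a \<Rightarrow> 'a \<Rightarrow> 'a pair_pre_digraph" where
  "switch G u v x y =
     \<lparr>pverts = pverts G,
      parcs = (parcs G - {(u, v), (v, u), (x, y), (y, x)}) \<union> {(u, y), (y, u), (x, v), (v, x)}\<rparr>"

lemma pverts_switch [simp]: "pverts (switch G u v x y) = pverts G"
  and parcs_switch: "parcs (switch G u v x y) =
    (parcs G - {(u, v), (v, u), (x, y), (y, x)}) \<union> {(u, y), (y, u), (x, v), (v, x)}"
  by (simp_all add: switch_def)

text \<open>The new pairs have to be absent from \<open>G\<close> and must not be loops, so that the
  switched graph is simple with as many edges as before. Absence does not exclude loops, as a loop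
  is never an arc; hence the separate \<open>no_loops\<close>.\<close>

locale switchable =
  fixes G :: "'a pair_pre_digraph" and u v x y :: 'a
  assumes pair_graph: "pair_graph G"
    and edges: "(u, v) \<in> parcs G" "(x, y) \<in> parcs G"
    and nonedges: "(u, y) \<notin> parcs G" "(x, v) \<notin> parcs G"
    and no_loops: "u \<noteq> y" "x \<noteq> v"
begin

abbreviation "H \<equiv> switch G u v x y"

lemma sym_arc: "(s, t) \<in> parcs G \<Longrightarrow> (t, s) \<in> parcs G"
  using pair_graph by (auto simp: pair_graph_iff dest: symD)

lemma distinct: "distinct [u, v, x, y]"
  using pair_graph edges nonedges no_loops by (auto simp: pair_graph_iff irrefl_def)

text \<open>One balance for two purposes: with the indicator of arcs leaving a vertex it shows that
  degrees are preserved, and with squared differences it gives the change of energy.\<close>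

lemma sum_parcs_switch:
  fixes \<phi> :: "'a \<times> 'a \<Rightarrow> 'b :: ab_group_add"
  shows "sum \<phi> (parcs H) = sum \<phi> (parcs G)
     - (\<phi> (u, v) + \<phi> (v, u) + \<phi> (x, y) + \<phi> (y, x)) + (\<phi> (u, y) + \<phi> (y, u) + \<phi> (x, v) + \<phi> (v, x))"
proof -
  let ?D = "{(u, v), (v, u), (x, y), (y, x)}" and ?N = "{(u, y), (y, u), (x, v), (v, x)}"
  have "?N \<inter> parcs G = {}"
    using nonedges sym_arc by auto
  then have "sum \<phi> (parcs H) = sum \<phi> (parcs G - ?D) + sum \<phi> ?N"
    unfolding parcs_switch using finite_parcs[OF pair_graph]
    by (subst sum.union_disjoint) auto
  moreover have "sum \<phi> (parcs G - ?D) = sum \<phi> (parcs G) - sum \<phi> ?D"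
    using edges sym_arc finite_parcs[OF pair_graph] by (subst sum_diff) auto
  ultimately show ?thesis
    using distinct by (simp add: algebra_simps)
qed

lemma pair_graph_switch: "pair_graph H"
  using pair_graph edges distinct unfolding pair_graph_iff parcs_switch pverts_switch
  by (auto simp: sym_def irrefl_def)

lemma out_degree_switch: "out_degree (with_proj H) = out_degree (with_proj G)"
proof
  fix w :: 'a
  have *: "int (out_degree (with_proj K) w) = (\<Sum>e\<in>parcs K. of_bool (fst e = w))"
    if "pair_graph K" for K
    using finite_parcs[OF that] by (simp add: out_degree_def out_arcs_def sum.If_cases of_bool_def Int_def)
  show "out_degree (with_proj H) w = out_degree (with_proj G) w"
    using *[OF pair_graph] *[OF pair_graph_switch] sum_parcs_switch[of "\<lambda>e. of_bool (fst e = w) :: int"]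
    by simp
qed

lemma card_edge_set_switch: "card (edge_set H) = card (edge_set G)"
proof -
  have fin: "finite (edge_set G)"
    by (rule finite_subset[of _ "(\<lambda>(s, t). {s, t}) ` parcs G"])
       (use finite_parcs[OF pair_graph] in \<open>auto simp: edge_set_def\<close>)
  have "e \<in> edge_set H \<longleftrightarrow> e \<in> (edge_set G - {{u, v}, {x, y}}) \<union> {{u, y}, {x, v}}" for e
  proof (cases "\<exists>s t. e = {s, t}")
    case True
    then obtain s t where e: "e = {s, t}" by blast
    show ?thesis
      unfolding e Un_iff Diff_iff insert_iff empty_iff doubleton_eq_iff parcs_switch prod.inject
        doubleton_in_edge_set_iff[OF pair_graph] doubleton_in_edge_set_iff[OF pair_graph_switch]
      by blast
  next
    case False
    then show ?thesis by (auto simp: edge_set_def)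
  qed
  then have "edge_set H = (edge_set G - {{u, v}, {x, y}}) \<union> {{u, y}, {x, v}}"
    by blast
  moreover have "{{u, v}, {x, y}} \<subseteq> edge_set G"
    using edges by (auto simp: edge_set_def)
  moreover have "{{u, y}, {x, v}} \<inter> edge_set G = {}"
    using nonedges by (auto simp: doubleton_in_edge_set_iff[OF pair_graph])
  moreover have "card {{u, v}, {x, y}} = 2" "card {{u, y}, {x, v}} = 2"
    using distinct by (auto simp: doubleton_eq_iff)
  moreover have "card {{u, v}, {x, y}} \<le> card (edge_set G)"
    using fin calculation(2) by (rule card_mono)
  ultimately show ?thesis
    using fin by (subst \<open>edge_set H = _\<close>, subst card_Un_disjoint) (auto simp: card_Diff_subset)
qed

text \<open>If \<open>u\<close> and \<open>x\<close> stay linked without the two deleted edges, then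
  \<open>u\<close> reaches \<open>v\<close> through \<open>x\<close>, and \<open>x\<close> reaches
  \<open>y\<close> through \<open>u\<close>. So each lost edge is replaced by a walk.\<close>

lemma connected_switch:
  assumes "connected (with_proj G)"
    and ux: "(u, x) \<in> (parcs G - {(u, v), (v, u), (x, y), (y, x)})\<^sup>*"
  shows "connected (with_proj H)"
proof -
  let ?D = "{(u, v), (v, u), (x, y), (y, x)}"
  have symH: "sym ((parcs H)\<^sup>*)"
    using pair_graph_switch by (intro sym_rtrancl) (auto simp: pair_graph_iff)
  have sub: "parcs G - ?D \<subseteq> parcs H"
    by (auto simp: parcs_switch)
  have ux': "(u, x) \<in> (parcs H)\<^sup>*"
    using ux rtrancl_mono[OF sub] by blast
  have new: "(u, y) \<in> parcs H" "(x, v) \<in> parcs H"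
    by (auto simp: parcs_switch)
  have uv: "(u, v) \<in> (parcs H)\<^sup>*"
    using ux' new(2) by (rule rtrancl_into_rtrancl)
  have xy: "(x, y) \<in> (parcs H)\<^sup>*"
    using symD[OF symH ux'] new(1) by (rule rtrancl_into_rtrancl)
  have "parcs G \<subseteq> (parcs H)\<^sup>*"
    using sub uv xy symD[OF symH uv] symD[OF symH xy] by auto
  then have "(parcs G)\<^sup>* \<subseteq> (parcs H)\<^sup>*"
    by (metis rtrancl_subset_rtrancl)
  then show ?thesis
    using assms(1) by (auto simp: connected_iff_rtrancl pair_graph pair_graph_switch)
qed

lemma unicyclic_class_switch:
  assumes "G \<in> unicyclic_class \<pi>"
    and "(u, x) \<in> (parcs G - {(u, v), (v, u), (x, y), (y, x)})\<^sup>*"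
  shows "H \<in> unicyclic_class \<pi>"
  using assms connected_switch[OF _ assms(2)] pair_graph_switch card_edge_set_switch out_degree_switch
  by (auto simp: unicyclic_class_def unicyclic_def degree_multiset_def)

lemma boundary_vertices_switch: "boundary_vertices H = boundary_vertices G"
  by (simp add: boundary_vertices_def out_degree_switch)

end

section \<open>The variational principle and the switching inequality\<close>

lemma first_dirichlet_eigenvalue_le:
  assumes "pair_graph G" and "\<forall>w \<in> boundary_vertices G. g w = 0"
  shows "first_dirichlet_eigenvalue G * (\<Sum>w\<in>pverts G. (g w)\<^sup>2) \<le> (\<Sum>(s, t)\<in>parcs G. (g s - g t)\<^sup>2) / 2"
    (is "_ * ?N \<le> ?E")
proof (cases "\<exists>w \<in> pverts G. g w \<noteq> 0")
  case True
  have fin: "finite (pverts G)"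
    using assms by (simp add: pair_graph_iff)
  then have pos: "0 < ?N"
    using True by (auto simp: intro!: sum_pos2)
  have "bdd_below (rayleigh_quotient G ` {g. dirichlet_function G g})"
    by (rule bdd_belowI[of _ 0])
       (auto simp: rayleigh_quotient_def intro!: divide_nonneg_nonneg sum_nonneg)
  moreover have "dirichlet_function G g"
    using True assms by (simp add: dirichlet_function_def)
  ultimately have "first_dirichlet_eigenvalue G \<le> rayleigh_quotient G g"
    unfolding first_dirichlet_eigenvalue_def by (auto intro: cINF_lower)
  then show ?thesis
    using pos by (simp add: rayleigh_quotient_def pos_le_divide_eq)
next
  \<comment> \<open>With the norm multiplied out, the bound also holds for the zero function, which
    has no Rayleigh quotient.\<close>
  case False
  then have "?N = 0" by simp
  moreover have "0 \<le> ?E" by (auto intro!: sum_nonneg divide_nonneg_nonneg)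
  ultimately show ?thesis by simp
qed

text \<open>The shape of the degree sequence is recorded as a gap in the degrees: every vertex is a
  leaf or has at least three neighbours.\<close>

locale faber_krahn_unicyclic =
  fixes \<pi> :: "nat list" and G :: "'a pair_pre_digraph" and f :: "'a \<Rightarrow> real"
  assumes faber_krahn: "faber_krahn \<pi> G"
    and first_eigenfunction: "first_eigenfunction G f"
    and out_degree_cases: "w \<in> pverts G \<Longrightarrow> out_degree (with_proj G) w = 1 \<or> 3 \<le> out_degree (with_proj G) w"
begin

lemma pair_graph: "pair_graph G"
  using faber_krahn by (simp add: faber_krahn_def unicyclic_class_def unicyclic_def)

lemma
  shows finite_pverts: "finite (pverts G)"
    and arc_pverts: "(s, t) \<in> parcs G \<Longrightarrow> s \<in> pverts G" "(s, t) \<in> parcs G \<Longrightarrow> t \<in> pverts G"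
    and sym_arc: "(s, t) \<in> parcs G \<Longrightarrow> (t, s) \<in> parcs G"
    and no_loop: "(s, s) \<notin> parcs G"
  using pair_graph unfolding pair_graph_iff irrefl_def by (blast dest: symD)+

lemma connected: "pverts G \<noteq> {}" "s \<in> pverts G \<Longrightarrow> t \<in> pverts G \<Longrightarrow> (s, t) \<in> (parcs G)\<^sup>*"
  using faber_krahn pair_graph
  by (auto simp: faber_krahn_def unicyclic_class_def unicyclic_def connected_iff_rtrancl)

lemma boundary_or_interior: "w \<in> pverts G \<Longrightarrow> w \<in> boundary_vertices G \<or> w \<in> interior_vertices G"
  using out_degree_cases by (force simp: boundary_vertices_def interior_vertices_def)

lemma f_boundary: "w \<in> boundary_vertices G \<Longrightarrow> f w = 0"
  and f_interior: "w \<in> interior_vertices G \<Longrightarrow> 0 < f w"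
  using first_eigenfunction by (simp_all add: first_eigenfunction_def)

lemma f_nonneg: "w \<in> pverts G \<Longrightarrow> 0 \<le> f w"
  and f_pos_iff: "w \<in> pverts G \<Longrightarrow> 0 < f w \<longleftrightarrow> w \<in> interior_vertices G"
  using boundary_or_interior[of w] f_boundary[of w] f_interior[of w] by auto

lemma laplacian_f: "w \<in> interior_vertices G \<Longrightarrow> laplacian_apply G f w = first_dirichlet_eigenvalue G * f w"
  using first_eigenfunction by (simp add: first_eigenfunction_def dirichlet_eigenfunction_def)

text \<open>The weak form of the eigenvalue equation. The equation may fail at boundary vertices,
  but there the test function vanishes.\<close>

lemma sum_parcs_f_eq:
  assumes "\<forall>w \<in> boundary_vertices G. h w = 0"
  shows "(\<Sum>(s, t)\<in>parcs G. (f s - f t) * (h s - h t)) =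
    2 * first_dirichlet_eigenvalue G * (\<Sum>w\<in>pverts G. f w * h w)"
proof -
  have "h w * laplacian_apply G f w = first_dirichlet_eigenvalue G * (f w * h w)" if "w \<in> pverts G" for w
    using boundary_or_interior[OF that] assms laplacian_f by auto
  then have "(\<Sum>w\<in>pverts G. h w * laplacian_apply G f w) =
      (\<Sum>w\<in>pverts G. first_dirichlet_eigenvalue G * (f w * h w))"
    by (rule sum.cong[OF refl])
  then show ?thesis
    by (simp add: green_formula[OF pair_graph] sum_distrib_left[symmetric])
qed

text \<open>Perturbing \<open>f\<close> at \<open>u\<close> makes the conclusion strict: the Rayleigh quotient of the switched
  graph at \<open>f\<close> alone only excludes \<open>f u > f x\<close> together with \<open>f v < f y\<close>.\<close>

lemma switching:
  assumes edges: "(u, v) \<in> parcs G" "(x, y) \<in> parcs G"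
    and nonedges: "(u, y) \<notin> parcs G" "(x, v) \<notin> parcs G"
    and neq: "u \<noteq> y" "x \<noteq> v"
    and ux: "(u, x) \<in> (parcs G - {(u, v), (v, u), (x, y), (y, x)})\<^sup>*"
    and le: "f x \<le> f u" and pos: "0 < f u"
  shows "f y \<le> f v"
proof (rule ccontr)
  assume "\<not> f y \<le> f v"
  define D where "D = f y - f v"
  have D: "0 < D"
    using \<open>\<not> f y \<le> f v\<close> by (simp add: D_def)
  interpret switchable G u v x y
    by (rule switchable.intro) (fact pair_graph edges nonedges neq)+
  let ?l = "first_dirichlet_eigenvalue G"
  have u: "u \<in> pverts G" "u \<in> interior_vertices G"
    using arc_pverts(1)[OF edges(1)] pos f_pos_iff by auto
  \<comment> \<open>The direction of the perturbation is the indicator of \<open>u\<close>. It is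
    admissible because \<open>f u > 0\<close> makes \<open>u\<close> interior.\<close>
  define e where "e = (\<lambda>w. if w = u then 1 else 0 :: real)"
  define K where "K = (\<Sum>(s, t)\<in>parcs G. (e s - e t)\<^sup>2) / 2"
  have e0: "\<forall>w \<in> boundary_vertices G. e w = 0"
    using u by (auto simp: e_def boundary_vertices_def interior_vertices_def)
  have f0: "\<forall>w \<in> boundary_vertices G. f w = 0"
    using f_boundary by blast
  have "?l \<le> first_dirichlet_eigenvalue H"
    using faber_krahn unicyclic_class_switch[OF _ ux] by (auto simp: faber_krahn_def)
  \<comment> \<open>For \<open>f + t e\<close> on \<open>G\<close>, energy minus \<open>?l\<close>
    times squared norm has no linear term in \<open>t\<close>, as \<open>f\<close> is an
    eigenfunction; \<open>t\<^sup>2 * (K - ?l)\<close> remains. The switch subtracts at least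
    \<open>2 * t * D\<close>, and by minimality the result is still nonnegative.\<close>
  then have main: "2 * t * D \<le> t\<^sup>2 * (K - ?l)" if t: "0 < t" for t
  proof -
    define g where "g = (\<lambda>w. f w + t * e w)"
    have g0: "\<forall>w \<in> boundary_vertices H. g w = 0"
      using e0 f0 by (simp add: g_def boundary_vertices_switch)
    have norm: "(\<Sum>w\<in>pverts G. (g w)\<^sup>2) = (\<Sum>w\<in>pverts G. (f w)\<^sup>2) + 2 * t * f u + t\<^sup>2"
    proof -
      have "(\<Sum>w\<in>pverts G. (g w)\<^sup>2) =
          (\<Sum>w\<in>pverts G. (f w)\<^sup>2 + (if w = u then 2 * t * f u + t\<^sup>2 else 0))"
        by (rule sum.cong) (auto simp: g_def e_def power2_eq_square algebra_simps)
      then show ?thesis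
        using u finite_pverts by (simp add: sum.distrib)
    qed
    have "(\<Sum>(s, w)\<in>parcs G. (g s - g w)\<^sup>2) = (\<Sum>(s, w)\<in>parcs G. (f s - f w) * (f s - f w))
        + 2 * t * (\<Sum>(s, w)\<in>parcs G. (f s - f w) * (e s - e w)) + t\<^sup>2 * (\<Sum>(s, w)\<in>parcs G. (e s - e w)\<^sup>2)"
      unfolding sum_distrib_left sum.distrib[symmetric]
      by (rule sum.cong) (auto simp: g_def power2_eq_square algebra_simps)
    also have "\<dots> = 2 * ?l * (\<Sum>w\<in>pverts G. f w * f w) + 2 * t * (2 * ?l * f u) + 2 * t\<^sup>2 * K"
      using u finite_pverts
      by (simp add: sum_parcs_f_eq[OF f0] sum_parcs_f_eq[OF e0] K_def)
         (simp add: e_def if_distrib cong: if_cong)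
    finally have energy: "(\<Sum>(s, w)\<in>parcs G. (g s - g w)\<^sup>2) =
        2 * ?l * (\<Sum>w\<in>pverts G. (f w)\<^sup>2) + 4 * t * ?l * f u + 2 * t\<^sup>2 * K"
      by (simp add: power2_eq_square)
    have "g u - g x = f u - f x + t" and "g v - g y = - D"
      using distinct by (auto simp: g_def e_def D_def)
    moreover have "(\<Sum>(s, w)\<in>parcs H. (g s - g w)\<^sup>2) =
        (\<Sum>(s, w)\<in>parcs G. (g s - g w)\<^sup>2) + 4 * ((g u - g x) * (g v - g y))"
      unfolding sum_parcs_switch by (simp add: power2_eq_square algebra_simps)
    ultimately have energyH: "(\<Sum>(s, w)\<in>parcs H. (g s - g w)\<^sup>2) =
        (\<Sum>(s, w)\<in>parcs G. (g s - g w)\<^sup>2) - 4 * ((f u - f x + t) * D)"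
      by simp
    have "?l * (\<Sum>w\<in>pverts G. (g w)\<^sup>2) \<le> first_dirichlet_eigenvalue H * (\<Sum>w\<in>pverts G. (g w)\<^sup>2)"
      using \<open>?l \<le> _\<close> by (intro mult_right_mono sum_nonneg) auto
    also have "\<dots> \<le> (\<Sum>(s, w)\<in>parcs H. (g s - g w)\<^sup>2) / 2"
      using first_dirichlet_eigenvalue_le[OF pair_graph_switch g0] by simp
    finally have "2 * ((f u - f x + t) * D) \<le> t\<^sup>2 * (K - ?l)"
      by (simp add: norm energy energyH algebra_simps)
    moreover have "t * D \<le> (f u - f x + t) * D"
      using le D by (intro mult_right_mono) auto
    ultimately show ?thesis by simp
  qed
  \<comment> \<open>Small enough that \<open>t * (K - ?l)\<close> is at most \<open>D\<close>,
    whereas \<open>main\<close> demands \<open>2 * D\<close>. The added 1 keeps the denominator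
    positive.\<close>
  define t where "t = D / (\<bar>K - ?l\<bar> + 1)"
  have t: "0 < t"
    using D by (simp add: t_def add_nonneg_pos)
  have "t * (2 * D) \<le> t * (t * (K - ?l))"
    using main[OF t] by (simp add: power2_eq_square mult.assoc mult.left_commute)
  then have "2 * D \<le> t * (K - ?l)"
    using t by simp
  also have "\<dots> \<le> t * (\<bar>K - ?l\<bar> + 1)"
    using t by (intro mult_left_mono) auto
  also have "\<dots> = D"
    by (simp add: t_def add_nonneg_pos)
  finally show False
    using D by simp
qed

end

section \<open>Breadth-first trees\<close>

lemma awalk_iff_relpow:
  assumes "pair_graph G" "u \<in> pverts G"
  shows "(\<exists>p. pre_digraph.awalk (with_proj G) u p v \<and> length p = n) \<longleftrightarrow> (u, v) \<in> parcs G ^^ n"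
  using assms(2)
proof (induction n arbitrary: u)
  case 0
  then show ?case by (auto simp: pre_digraph.awalk_def cas_with_proj_eq)
next
  case (Suc n)
  interpret pair_graph G by fact
  have "(\<exists>p. awalk u p v \<and> length p = Suc n) \<longleftrightarrow>
      (\<exists>w. (u, w) \<in> parcs G \<and> (\<exists>p. awalk w p v \<and> length p = n))"
    by (fastforce simp: length_Suc_conv awalk_Cons_iff intro: exI[of _ "(u, _) # _"])
  also have "\<dots> \<longleftrightarrow> (\<exists>w. (u, w) \<in> parcs G \<and> (w, v) \<in> parcs G ^^ n)"
    using Suc.IH in_arcsD2 by blast
  also have "\<dots> \<longleftrightarrow> (u, v) \<in> parcs G ^^ Suc n"
    by (meson relpow_Suc_D2 relpow_Suc_I2)
  finally show ?case .
qed

context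
  fixes G :: "'a pair_pre_digraph" and r :: 'a
  assumes G: "pair_graph G" "connected (with_proj G)" and r: "r \<in> pverts G"
begin

lemma hop_dist_relpow: "v \<in> pverts G \<Longrightarrow> (r, v) \<in> parcs G ^^ hop_dist G r v"
  and hop_dist_le: "(r, v) \<in> parcs G ^^ n \<Longrightarrow> hop_dist G r v \<le> n"
proof -
  have eq: "hop_dist G r v = (LEAST n. (r, v) \<in> parcs G ^^ n)" for v
    unfolding hop_dist_def awalk_iff_relpow[OF G(1) r] ..
  show "(r, v) \<in> parcs G ^^ hop_dist G r v" if "v \<in> pverts G"
  proof -
    have "(r, v) \<in> (parcs G)\<^sup>*"
      using G r that by (auto simp: connected_iff_rtrancl)
    then show ?thesis
      unfolding eq by (metis rtrancl_imp_relpow LeastI)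
  qed
  show "hop_dist G r v \<le> n" if "(r, v) \<in> parcs G ^^ n"
    unfolding eq using that by (rule Least_le)
qed

lemma hop_dist_root: "hop_dist G r r = 0"
  using hop_dist_le[of r 0] by simp

lemma hop_dist_arc_le:
  assumes "(u, v) \<in> parcs G"
  shows "hop_dist G r v \<le> Suc (hop_dist G r u)"
  using assms G(1) hop_dist_relpow[of u] by (intro hop_dist_le) (auto simp: pair_graph_iff)

lemma ex_hop_dist_pred:
  assumes "v \<in> pverts G" "v \<noteq> r"
  obtains u where "(u, v) \<in> parcs G" "Suc (hop_dist G r u) = hop_dist G r v"
proof -
  obtain n where n: "hop_dist G r v = Suc n"
    using hop_dist_relpow[OF assms(1)] assms(2) by (cases "hop_dist G r v") auto
  then obtain u where u: "(r, u) \<in> parcs G ^^ n" "(u, v) \<in> parcs G"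
    using hop_dist_relpow[OF assms(1)] by auto
  then have "Suc (hop_dist G r u) = hop_dist G r v"
    using hop_dist_le[OF u(1)] hop_dist_arc_le[OF u(2)] n by linarith
  with u(2) show thesis by (rule that)
qed

text \<open>Joining each vertex other than \<open>r\<close> to a neighbour one level up uses one
  edge fewer than there are vertices. As vertices and edges are equal in number, exactly one edge
  \<open>ab\<close> is left over.\<close>

lemma bfs_tree_exists:
  assumes card: "card (pverts G) = card (edge_set G)"
  obtains par a b where
    "\<And>v. v \<in> pverts G \<Longrightarrow> v \<noteq> r \<Longrightarrow> (v, par v) \<in> parcs G \<and> Suc (hop_dist G r (par v)) = hop_dist G r v"
    "\<And>s t. (s, t) \<in> parcs G \<Longrightarrow> s \<noteq> r \<and> par s = t \<or> t \<noteq> r \<and> par t = s \<or> {s, t} = {a, b}"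
    "(a, b) \<in> parcs G" "a \<noteq> r" "b \<noteq> r" "par a \<noteq> b" "par b \<noteq> a"
proof -
  let ?h = "hop_dist G r"
  have fin: "finite (pverts G)" and sym: "\<And>s t. (s, t) \<in> parcs G \<Longrightarrow> (t, s) \<in> parcs G"
    and wf: "\<And>s t. (s, t) \<in> parcs G \<Longrightarrow> s \<in> pverts G"
    using G(1) by (auto simp: pair_graph_iff dest: symD)
  have "\<exists>u. (v, u) \<in> parcs G \<and> Suc (?h u) = ?h v" if "v \<in> pverts G" "v \<noteq> r" for v
    using ex_hop_dist_pred[OF that] sym by metis
  then obtain par where
    par: "\<And>v. v \<in> pverts G \<Longrightarrow> v \<noteq> r \<Longrightarrow> (v, par v) \<in> parcs G \<and> Suc (?h (par v)) = ?h v"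
    by metis
  define T where "T = (\<lambda>v. {v, par v}) ` (pverts G - {r})"
  have T: "T \<subseteq> edge_set G"
    unfolding T_def by (rule image_subsetI) (use par doubleton_in_edge_set_iff[OF G(1)] in blast)
  have finE: "finite (edge_set G)"
    by (rule finite_subset[of _ "(\<lambda>(s, t). {s, t}) ` parcs G"])
       (use finite_parcs[OF G(1)] in \<open>auto simp: edge_set_def\<close>)
  \<comment> \<open>Two vertices with the same parent edge would be parents of each other, which the
    levels forbid.\<close>
  have "inj_on (\<lambda>v. {v, par v}) (pverts G - {r})"
  proof (rule inj_onI)
    fix v w assume v: "v \<in> pverts G - {r}" and w: "w \<in> pverts G - {r}" and eq: "{v, par v} = {w, par w}"
    show "v = w"
    proof (rule ccontr)
      assume "v \<noteq> w"
      then have "v = par w" "w = par v"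
        using eq by (auto simp: doubleton_eq_iff)
      then show False
        using par[of v] par[of w] v w by auto
    qed
  qed
  then have "card T = card (pverts G) - 1"
    using r fin by (simp add: T_def card_image)
  moreover have "0 < card (pverts G)"
    using r fin by (auto simp: card_gt_0_iff)
  ultimately have "card (edge_set G - T) = 1"
    using T finE card by (simp add: card_Diff_subset finite_subset)
  then obtain e where e: "edge_set G - T = {e}"
    by (auto simp: card_1_singleton_iff)
  then have "e \<in> edge_set G" by blast
  then obtain a b where ab: "(a, b) \<in> parcs G" "e = {a, b}"
    by (auto simp: edge_set_def)
  have not_tree: "{a, b} \<noteq> {v, par v}" if "v \<in> pverts G" "v \<noteq> r" for v
    using e ab that by (auto simp: T_def)
  \<comment> \<open>A neighbour of the root has level 1, so its parent is the root and the edge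
    between them is a tree edge.\<close>
  have nr: "s \<noteq> r" if st: "(s, t) \<in> parcs G" "{s, t} = {a, b}" for s t
  proof
    assume "s = r"
    have t: "t \<in> pverts G" "t \<noteq> r"
      using st(1) sym wf G(1) \<open>s = r\<close> by (auto simp: pair_graph_iff irrefl_def)
    have "Suc (?h (par t)) \<le> Suc 0"
      using par[OF t] hop_dist_arc_le[OF st(1)] hop_dist_root \<open>s = r\<close> by simp
    then have "(r, par t) \<in> parcs G ^^ 0"
      using hop_dist_relpow[of "par t"] par[OF t] sym wf by fastforce
    then show False
      using not_tree[OF t] st(2) \<open>s = r\<close> by auto
  qed
  have "a \<noteq> r" "b \<noteq> r"
    using nr[of a b] nr[of b a] ab sym by auto
  moreover have "par a \<noteq> b" "par b \<noteq> a"
    using not_tree[of a] not_tree[of b] ab(1) wf sym calculation by (auto simp: insert_commute)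
  moreover have "s \<noteq> r \<and> par s = t \<or> t \<noteq> r \<and> par t = s \<or> {s, t} = {a, b}" if "(s, t) \<in> parcs G" for s t
  proof (cases "{s, t} \<in> T")
    case True
    then show ?thesis by (auto simp: T_def doubleton_eq_iff)
  next
    case False
    then have "{s, t} \<in> edge_set G - T"
      using that by (simp add: doubleton_in_edge_set_iff[OF G(1)])
    then show ?thesis
      unfolding e ab(2) by simp
  qed
  ultimately show thesis
    using ab(1) by (intro that[of par a b, OF par]) auto
qed

end

text \<open>The level \<open>h\<close> is kept abstract: the tree arguments rely on its growing by
  one from parent to child. It is identified with the distance from \<open>r\<close> when the
  ordering is built.\<close>

locale bfs_tree = faber_krahn_unicyclic \<pi> G f
  for \<pi> :: "nat list" and G :: "'a pair_pre_digraph" and f :: "'a \<Rightarrow> real" +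
  fixes r :: 'a and h :: "'a \<Rightarrow> nat" and par :: "'a \<Rightarrow> 'a" and a b :: 'a
  assumes root: "r \<in> pverts G" "h r = 0" "\<And>v. v \<in> pverts G \<Longrightarrow> f v \<le> f r"
    and par: "\<And>v. v \<in> pverts G \<Longrightarrow> v \<noteq> r \<Longrightarrow> (v, par v) \<in> parcs G \<and> Suc (h (par v)) = h v"
    and arc_cases: "\<And>s t. (s, t) \<in> parcs G \<Longrightarrow> s \<noteq> r \<and> par s = t \<or> t \<noteq> r \<and> par t = s \<or> {s, t} = {a, b}"
    and extra: "(a, b) \<in> parcs G" "a \<noteq> r" "b \<noteq> r" "par a \<noteq> b" "par b \<noteq> a"
begin

section \<open>Ancestor paths and switchings in the tree\<close>

definition up :: "'a rel" where
  "up = {(v, par v) | v. v \<in> pverts G \<and> v \<noteq> r}"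

lemma par_in: "v \<in> pverts G \<Longrightarrow> v \<noteq> r \<Longrightarrow> par v \<in> pverts G"
  using par arc_pverts(2) by blast

lemma h_par: "v \<in> pverts G \<Longrightarrow> v \<noteq> r \<Longrightarrow> h v = Suc (h (par v))"
  using par by simp

lemma up_iff: "(s, t) \<in> up \<longleftrightarrow> s \<in> pverts G \<and> s \<noteq> r \<and> t = par s"
  by (auto simp: up_def)

lemma ab_in: "a \<in> pverts G" "b \<in> pverts G" "a \<noteq> b"
  using arc_pverts[OF extra(1)] extra(1) no_loop by auto

lemma up_rtrancl_h:
  assumes "(s, t) \<in> up\<^sup>*" shows "s = t \<or> h t < h s"
  using assms by (induction rule: rtrancl_induct) (use h_par in \<open>fastforce simp: up_iff\<close>)+

lemma up_trancl_h: "(s, t) \<in> up\<^sup>+ \<Longrightarrow> h t < h s"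
  by (induction rule: trancl_induct) (use h_par in \<open>fastforce simp: up_iff\<close>)+

lemma up_rtrancl_root: "v \<in> pverts G \<Longrightarrow> (v, r) \<in> up\<^sup>*"
proof (induction "h v" arbitrary: v rule: less_induct)
  case less
  show ?case
  proof (cases "v = r")
    case False
    then have "(par v, r) \<in> up\<^sup>*"
      using less h_par par_in by simp
    then show ?thesis
      using False less.prems by (meson converse_rtrancl_into_rtrancl up_iff)
  qed simp
qed

text \<open>Supplies the connectivity condition of \<open>switching\<close>: only the tree edges
  between \<open>q\<close> and its ancestor \<open>z\<close> have to survive the deletion of
  \<open>D\<close>.\<close>

lemma climb:
  assumes "(q, z) \<in> up\<^sup>*"
    and "\<And>s. (q, s) \<in> up\<^sup>* \<Longrightarrow> (s, z) \<in> up\<^sup>+ \<Longrightarrow> (s, par s) \<notin> D"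
  shows "(q, z) \<in> (parcs G - D)\<^sup>*"
  using assms
proof (induction rule: converse_rtrancl_induct)
  case (step q q')
  have "(q, z) \<in> up\<^sup>+"
    using step.hyps by (rule rtrancl_into_trancl2)
  then have "(q, q') \<in> parcs G - D"
    using step.hyps(1) step.prems[of q] par by (auto simp: up_iff)
  moreover have "(q', z) \<in> (parcs G - D)\<^sup>*"
    using step.IH step.prems step.hyps(1) by (meson converse_rtrancl_into_rtrancl)
  ultimately show ?case by (rule converse_rtrancl_into_rtrancl)
qed simp

text \<open>Both vertices climb to the root, and one of the two paths is walked backwards; hence
  \<open>D\<close> has to be symmetric.\<close>

lemma climb_via_root:
  assumes "u \<in> pverts G" "x \<in> pverts G" and sym: "D\<inverse> = D"
    and avoid: "\<And>s. s \<in> pverts G \<Longrightarrow> s \<noteq> r \<Longrightarrow> (u, s) \<in> up\<^sup>* \<or> (x, s) \<in> up\<^sup>* \<Longrightarrow> (s, par s) \<notin> D"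
  shows "(u, x) \<in> (parcs G - D)\<^sup>*"
proof -
  have "sym (parcs G - D)"
    using sym sym_arc by (auto simp: sym_def)
  then have "sym ((parcs G - D)\<^sup>*)"
    by (rule sym_rtrancl)
  moreover have "(u, r) \<in> (parcs G - D)\<^sup>*" "(x, r) \<in> (parcs G - D)\<^sup>*"
    using assms up_rtrancl_root by (auto intro!: climb avoid simp: up_iff dest: tranclD)
  ultimately show ?thesis
    by (meson rtrancl_trans symD)
qed

text \<open>The ancestor conditions keep \<open>v\<close> and \<open>y\<close> off the paths from
  both parents to the root, so the deleted edges are not on them. Excluding \<open>a\<close> and
  \<open>b\<close> ensures that neither new edge is the extra edge \<open>ab\<close>.\<close>

lemma switch_tree_edges:
  assumes v: "v \<in> pverts G" "v \<noteq> r" "v \<noteq> a" "v \<noteq> b" and y: "y \<in> pverts G" "y \<noteq> r" "y \<noteq> a" "y \<noteq> b"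
    and par_neq: "par v \<noteq> par y" and le: "f (par y) \<le> f (par v)" and pos: "0 < f (par v)"
    and anc: "(par v, y) \<notin> up\<^sup>*" "(par y, v) \<notin> up\<^sup>*"
  shows "f y \<le> f v"
proof (rule switching[of "par v" v "par y" y])
  have neq: "par v \<noteq> y" "par y \<noteq> v"
    using anc by auto
  have up: "(par v, y) \<notin> up" "(par y, v) \<notin> up"
    using anc by auto
  show "(par v, v) \<in> parcs G" "(par y, y) \<in> parcs G"
    using par v y sym_arc by auto
  show "(par v, y) \<notin> parcs G" "(par y, v) \<notin> parcs G"
    using arc_cases[of "par v" y] arc_cases[of "par y" v] v y up par_neq par_in
    by (auto simp: up_iff doubleton_eq_iff)
  show "par v \<noteq> y" "par y \<noteq> v" "f (par y) \<le> f (par v)" "0 < f (par v)"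
    by fact+
  show "(par v, par y) \<in> (parcs G - {(par v, v), (v, par v), (par y, y), (y, par y)})\<^sup>*"
  proof (rule climb_via_root)
    fix s assume s: "s \<in> pverts G" "s \<noteq> r" "(par v, s) \<in> up\<^sup>* \<or> (par y, s) \<in> up\<^sup>*"
    have "s \<noteq> v" "s \<noteq> y"
      using s anc up_rtrancl_h[of "par v" v] up_rtrancl_h[of "par y" y] h_par[of v] h_par[of y] v y by auto
    then show "(s, par s) \<notin> {(par v, v), (v, par v), (par y, y), (y, par y)}"
      using h_par[of v] h_par[of y] h_par[of s] v y s by auto
  qed (use par_in v y in auto)
qed

text \<open>The edge \<open>ab\<close> lies on no path up the tree. As \<open>v\<close> is not an
  ancestor of \<open>a\<close> or \<open>b\<close>, the edge \<open>uv\<close> is not on their paths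
  to the root either, so connectivity survives.\<close>

lemma switch_extra_edge:
  assumes xy: "(x, y) = (a, b) \<or> (x, y) = (b, a)"
    and v: "v \<in> pverts G" "v \<noteq> r" "(a, v) \<notin> up\<^sup>*" "(b, v) \<notin> up\<^sup>*"
    and u: "par v = u" "u \<noteq> a" "u \<noteq> b" "(u, y) \<notin> parcs G"
    and le: "f x \<le> f u" and pos: "0 < f u"
  shows "f y \<le> f v"
proof (rule switching[of u v x y])
  have neq: "v \<noteq> a" "v \<noteq> b"
    using v by auto
  have up: "(a, v) \<notin> up" "(b, v) \<notin> up"
    using v by auto
  show "(u, v) \<in> parcs G" "(x, y) \<in> parcs G"
    using par v u xy extra(1) sym_arc by auto
  show "(x, v) \<notin> parcs G"
    using arc_cases[of x v] xy up neq u extra ab_in by (auto simp: up_iff doubleton_eq_iff)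
  show "(u, x) \<in> (parcs G - {(u, v), (v, u), (x, y), (y, x)})\<^sup>*"
  proof (rule climb_via_root)
    fix s assume s: "s \<in> pverts G" "s \<noteq> r" "(u, s) \<in> up\<^sup>* \<or> (x, s) \<in> up\<^sup>*"
    have "s \<noteq> v"
      using s v u xy up_rtrancl_h[of u v] h_par[of v] by auto
    then show "(s, par s) \<notin> {(u, v), (v, u), (x, y), (y, x)}"
      using h_par[of v] h_par[of s] v u s xy extra by auto
  qed (use par_in v u xy ab_in in auto)
qed (use xy u v le pos in auto)

lemma three_le_degree_if_pos:
  assumes "v \<in> pverts G" "0 < f v"
  shows "3 \<le> card {w. (v, w) \<in> parcs G}"
  using out_degree_cases[OF assms(1)] assms f_pos_iff
  by (auto simp: interior_vertices_def out_degree_with_proj)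

lemma f_pos_if_two_neighbours:
  assumes "(v, s) \<in> parcs G" "(v, t) \<in> parcs G" "s \<noteq> t"
  shows "0 < f v"
proof -
  have "{w. (v, w) \<in> parcs G} \<subseteq> pverts G"
    using arc_pverts(2) by blast
  then have "card {s, t} \<le> card {w. (v, w) \<in> parcs G}"
    using assms finite_pverts by (intro card_mono) (auto intro: finite_subset)
  then have "v \<in> interior_vertices G"
    using assms arc_pverts(1) by (auto simp: interior_vertices_def out_degree_with_proj)
  then show ?thesis by (rule f_interior)
qed

lemma f_a_pos: "0 < f a" and f_b_pos: "0 < f b"
  using f_pos_if_two_neighbours[of a "par a" b] f_pos_if_two_neighbours[of b "par b" a]
    par extra ab_in sym_arc by auto

lemma ex_child:
  assumes q: "q \<in> pverts G" "q \<noteq> r" "q \<noteq> a" "q \<noteq> b" "0 < f q"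
  obtains q' where "q' \<in> pverts G" "q' \<noteq> r" "par q' = q"
proof -
  have "\<not> {w. (q, w) \<in> parcs G} \<subseteq> {par q}"
    using three_le_degree_if_pos[OF q(1,5)] card_mono[of "{par q}" "{w. (q, w) \<in> parcs G}"] by auto
  then obtain w where "(q, w) \<in> parcs G" "w \<noteq> par q"
    by blast
  then show thesis
    using arc_cases[of q w] q that[of w] arc_pverts(2)[of q w] by (auto simp: doubleton_eq_iff)
qed

text \<open>Switching each edge of a descending path with \<open>ab\<close>, in alternating orientation, would
  carry a positive lower bound for \<open>f\<close> down to a leaf.\<close>

lemma no_large_value_below:
  assumes "q \<in> pverts G" "q \<noteq> r" "par q \<noteq> a" "par q \<noteq> b" "(a, q) \<notin> up\<^sup>*" "(b, q) \<notin> up\<^sup>*"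
    and "f a \<le> f q \<or> f b \<le> f q"
  shows False
  using assms
proof (induction "Max (h ` pverts G) - h q" arbitrary: q rule: less_induct)
  case less
  \<comment> \<open>\<open>x\<close> is the end of \<open>ab\<close> whose value \<open>q\<close>
    dominates. The switch makes the child \<open>q'\<close> dominate the other end \<open>y\<close>,
    so the two ends may alternate during the descent.\<close>
  obtain x y where xy: "(x, y) = (a, b) \<or> (x, y) = (b, a)" and x: "f x \<le> f q"
    using less.prems(7) by blast
  have q: "q \<noteq> a" "q \<noteq> b"
    using less.prems by auto
  have pos: "0 < f q"
    using x xy f_a_pos f_b_pos by auto
  \<comment> \<open>Positivity always provides a further child, so the descent would never end; the
    measure is the depth that remains.\<close>
  obtain q' where q': "q' \<in> pverts G" "q' \<noteq> r" "par q' = q"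
    using ex_child less.prems(1,2) q pos by metis
  have "(q', q) \<in> up"
    using q' by (simp add: up_iff)
  then have anc: "(a, q') \<notin> up\<^sup>*" "(b, q') \<notin> up\<^sup>*"
    using less.prems(5,6) by (meson rtrancl_into_rtrancl)+
  have "(a, q) \<notin> up" "(b, q) \<notin> up"
    using less.prems(5,6) by auto
  then have "(q, y) \<notin> parcs G"
    using arc_cases[of q y] xy q less.prems ab_in extra by (auto simp: up_iff doubleton_eq_iff)
  then have "f y \<le> f q'"
    using switch_extra_edge[OF xy q'(1,2) anc q'(3)] q x pos by simp
  then have "f a \<le> f q' \<or> f b \<le> f q'"
    using xy by auto
  moreover have "h q' \<le> Max (h ` pverts G)"
    using q' finite_pverts by simp
  then have "Max (h ` pverts G) - h q' < Max (h ` pverts G) - h q"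
    using h_par[OF q'(1,2)] q'(3) by simp
  ultimately show False
    using less.hyps[of q'] q' q anc by auto
qed

section \<open>The cycle is a triangle through the root\<close>

lemma root_pos: "0 < f r"
  using f_a_pos root(3)[of a] ab_in by simp

lemma up_same_level:
  assumes "(q, s) \<in> up\<^sup>*" "(q, t) \<in> up\<^sup>*" "h s = h t"
  shows "s = t"
proof -
  have "single_valued up"
    by (auto simp: single_valued_def up_iff)
  then have "(s, t) \<in> up\<^sup>* \<or> (t, s) \<in> up\<^sup>*"
    using assms by (meson single_valued_confluent)
  then show ?thesis
    using up_rtrancl_h[of s t] up_rtrancl_h[of t s] assms(3) by auto
qed

lemma root_arc: "(r, w) \<in> parcs G \<longleftrightarrow> w \<in> pverts G \<and> w \<noteq> r \<and> par w = r"
  using arc_cases[of r w] par[of w] sym_arc extra arc_pverts no_loop by (auto simp: doubleton_eq_iff)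

text \<open>Ancestors of a vertex form a chain, so \<open>a\<close> and \<open>b\<close> each
  account for at most one child of the root. The root has at least three children, and one is
  left.\<close>

lemma ex_child_root:
  obtains w where "w \<in> pverts G" "w \<noteq> r" "par w = r" "(a, w) \<notin> up\<^sup>*" "(b, w) \<notin> up\<^sup>*"
proof -
  let ?N = "{w. (r, w) \<in> parcs G}"
  let ?X = "\<lambda>q. {w \<in> ?N. (q, w) \<in> up\<^sup>*}"
  have "finite ?N"
    by (rule finite_subset[OF _ finite_pverts]) (auto dest: arc_pverts)
  moreover have "card (?X q) \<le> 1" for q
  proof -
    have "s = t" if "s \<in> ?X q" "t \<in> ?X q" for s t
      using up_same_level[of q s t] that h_par[of s] h_par[of t] by (auto simp: root_arc)
    then show ?thesis
      using \<open>finite ?N\<close> by (simp add: card_le_Suc0_iff_eq)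
  qed
  then have "card (?X a \<union> ?X b) \<le> 2"
    using card_Un_le[of "?X a" "?X b"] \<open>card (?X a) \<le> 1\<close> \<open>card (?X b) \<le> 1\<close> by linarith
  then have "\<not> card ?N \<le> card (?X a \<union> ?X b)"
    using three_le_degree_if_pos[OF root(1) root_pos] by linarith
  then have "\<not> ?N \<subseteq> ?X a \<union> ?X b"
    using card_mono[of "?X a \<union> ?X b" ?N] \<open>finite ?N\<close> by fastforce
  then show thesis
    using that root_arc by blast
qed

text \<open>If \<open>y\<close> is not a child of the root, then \<open>ry\<close> is not an edge,
  and switching \<open>rw\<close> against \<open>xy\<close> gives \<open>f y \<le> f w\<close> for a
  child \<open>w\<close> of the root that is not above \<open>a\<close> or \<open>b\<close>. This is
  the large value that \<open>no_large_value_below\<close> excludes.\<close>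

lemma triangle: "par a = r" "par b = r"
proof -
  have *: "par y = r" if xy: "(x, y) = (a, b) \<or> (x, y) = (b, a)" for x y
  proof (rule ccontr)
    assume "par y \<noteq> r"
    then have "(r, y) \<notin> parcs G"
      by (simp add: root_arc)
    moreover obtain w where w: "w \<in> pverts G" "w \<noteq> r" "par w = r" "(a, w) \<notin> up\<^sup>*" "(b, w) \<notin> up\<^sup>*"
      using ex_child_root .
    moreover have "f x \<le> f r"
      using xy root(3) ab_in by auto
    ultimately have "f y \<le> f w"
      using switch_extra_edge[OF xy w(1,2,4,5,3)] extra root_pos by auto
    then show False
      using no_large_value_below[of w] w xy extra by auto
  qed
  show "par a = r" "par b = r"
    using *[of b a] *[of a b] by auto
qed

section \<open>Decrease of the eigenfunction away from the triangle\<close>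

lemma h_ab: "h a = 1" "h b = 1"
  using h_par[of a] h_par[of b] triangle ab_in extra root by auto

lemma up_rtrancl_triangle:
  assumes "(q, s) \<in> up\<^sup>*" "q = a \<or> q = b \<or> q = r"
  shows "s = a \<or> s = b \<or> s = r"
  using assms by (induction rule: rtrancl_induct) (auto simp: up_iff triangle)

text \<open>\<open>no_large_value_below\<close> need not apply to \<open>q\<close>, whose parent may
  be \<open>a\<close> or \<open>b\<close>, but it applies to a child of \<open>q\<close>. One
  switching passes the large value on to this child.\<close>

lemma off_triangle_less:
  assumes q: "q \<in> pverts G" "q \<noteq> r" "q \<noteq> a" "q \<noteq> b"
  shows "f q < f a" "f q < f b"
proof -
  have *: "f q < f x" if xy: "(x, y) = (a, b) \<or> (x, y) = (b, a)" for x y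
  proof (rule ccontr)
    assume "\<not> f q < f x"
    then have le: "f x \<le> f q" by simp
    have pos: "0 < f q"
      using le xy f_a_pos f_b_pos by auto
    obtain q' where q': "q' \<in> pverts G" "q' \<noteq> r" "par q' = q"
      using ex_child q pos by metis
    have anc: "(a, q) \<notin> up\<^sup>*" "(b, q) \<notin> up\<^sup>*" "(a, q') \<notin> up\<^sup>*" "(b, q') \<notin> up\<^sup>*"
      using up_rtrancl_triangle[of _ q] up_rtrancl_triangle[of _ q'] q q' triangle by auto
    have neq: "q' \<noteq> a" "q' \<noteq> b"
      using anc by auto
    have False if "f x \<le> f q' \<or> f y \<le> f q'"
      using no_large_value_below[of q'] q' q anc that xy by auto
    moreover have "f y \<le> f q'" if "par q \<noteq> y"
    proof -
      have "(q, y) \<notin> parcs G"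
        using arc_cases[of q y] that q xy triangle by (auto simp: doubleton_eq_iff)
      then show ?thesis
        using switch_extra_edge[OF xy q'(1,2) anc(3,4) q'(3)] q le pos by simp
    qed
    \<comment> \<open>Here \<open>qy\<close> is already an edge, so \<open>xy\<close> cannot serve;
      the edge \<open>xr\<close> is used instead. The path from \<open>q\<close> over
      \<open>y\<close> to \<open>x\<close> keeps the graph connected.\<close>
    moreover have "f r \<le> f q'" if "par q = y"
    proof (rule switching[of q q' x r])
      show "(q, q') \<in> parcs G" "(x, r) \<in> parcs G"
        using par[OF q'(1,2)] q'(3) par[of a] par[of b] triangle ab_in extra xy sym_arc by auto
      show "(q, r) \<notin> parcs G" "(x, q') \<notin> parcs G"
        using that arc_cases[of q r] arc_cases[of x q'] q q' neq xy triangle extra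
        by (auto simp: doubleton_eq_iff)
      have "(q, y) \<in> parcs G" "(y, x) \<in> parcs G"
        using par[OF q(1,2)] that xy extra(1) sym_arc by auto
      moreover have "y \<noteq> q'" "y \<noteq> r" "x \<noteq> q" "x \<noteq> r"
        using xy neq extra q by auto
      ultimately have "(q, y) \<in> parcs G - {(q, q'), (q', q), (x, r), (r, x)}"
        "(y, x) \<in> parcs G - {(q, q'), (q', q), (x, r), (r, x)}"
        using q no_loop by auto
      then show "(q, x) \<in> (parcs G - {(q, q'), (q', q), (x, r), (r, x)})\<^sup>*"
        by (meson r_into_rtrancl rtrancl_into_rtrancl)
      show "q \<noteq> r" "x \<noteq> q'" "f x \<le> f q" "0 < f q"
        using q xy neq le pos by auto
    qed
    moreover have "f x \<le> f r"
      using root(3) xy ab_in by auto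
    ultimately show False by force
  qed
  show "f q < f a" "f q < f b"
    using *[of a b] *[of b a] by auto
qed

text \<open>Induction on the level gives \<open>f x < f p\<close> for the parent \<open>x\<close>
  and grandparent \<open>p\<close>. A failure at \<open>y\<close> gives a deepest descendant
  \<open>q\<close> of \<open>x\<close> with \<open>f q \<ge> f x\<close>; switching the edge to a
  child \<open>q'\<close> of \<open>q\<close> against \<open>xp\<close> yields
  \<open>f p \<le> f q' < f x\<close>.\<close>

lemma less_par:
  assumes "y \<in> pverts G" "y \<noteq> r" "y \<noteq> a" "y \<noteq> b"
  shows "f y < f (par y)"
  using assms
proof (induction "h y" arbitrary: y rule: less_induct)
  case less
  define x where "x = par y"
  define p where "p = par x"
  have x: "x \<in> pverts G" and hx: "h y = Suc (h x)"
    using less.prems par_in h_par by (auto simp: x_def)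
  show ?case
  proof (cases "x = r \<or> x = a \<or> x = b")
    case True
    then show ?thesis
      using off_triangle_less[OF less.prems] root(3)[of a] ab_in by (auto simp: x_def)
  next
    case False
    then have p: "f x < f p" "h x = Suc (h p)" "(x, p) \<in> parcs G" "p \<in> pverts G"
      using less.hyps[of x] x hx par[of x] par_in[of x] unfolding p_def by auto
    have "(x, y) \<in> parcs G"
      using par[OF less.prems(1,2)] sym_arc by (simp add: x_def)
    then have x_pos: "0 < f x"
      using f_pos_if_two_neighbours[of x y p] p hx by fastforce
    show ?thesis
    proof (rule ccontr)
      assume "\<not> f y < f (par y)"
      let ?S = "{q \<in> pverts G. (q, x) \<in> up\<^sup>+ \<and> f x \<le> f q}"
      have "(y, x) \<in> up"
        using less.prems by (simp add: up_iff x_def)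
      then have "y \<in> ?S"
        using less.prems(1) \<open>\<not> f y < f (par y)\<close> by (simp add: x_def[symmetric] r_into_trancl')
      then have "\<exists>q. q \<in> ?S \<and> (\<forall>s. s \<in> ?S \<longrightarrow> h s \<le> h q)"
      proof (rule ex_has_greatest_nat)
        show "\<forall>s. s \<in> ?S \<longrightarrow> h s < Suc (Max (h ` pverts G))"
          using finite_pverts by (simp add: less_Suc_eq_le)
      qed
      then obtain q where q: "q \<in> ?S" and max: "\<And>s. s \<in> ?S \<Longrightarrow> h s \<le> h q"
        by (elim exE conjE) simp
      have hq: "h x < h q"
        using q by (simp add: up_trancl_h)
      have q_off: "q \<noteq> r" "q \<noteq> a" "q \<noteq> b"
        using q up_rtrancl_triangle[of q x] False trancl_into_rtrancl by fast+
      obtain q' where q': "q' \<in> pverts G" "q' \<noteq> r" "par q' = q"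
        using ex_child q q_off x_pos by (metis (no_types, lifting) less_le_trans mem_Collect_eq)
      have hq': "h q' = Suc (h q)"
        using h_par q' by simp
      have "(q', x) \<in> up\<^sup>+"
        using q q' by (metis (no_types, lifting) mem_Collect_eq trancl_into_trancl2 up_iff)
      then have "f q' < f x"
        using max[of q'] q' hq' by force
      moreover have "f p \<le> f q'"
      proof (rule switching[of q q' x p])
        show "(q, q') \<in> parcs G" "(x, p) \<in> parcs G"
          using par[OF q'(1,2)] q'(3) sym_arc p by auto
        show "(q, p) \<notin> parcs G" "(x, q') \<notin> parcs G"
          using arc_cases[of q p] arc_cases[of x q'] q_off False q q' hq hq' p h_par[of q] h_par[of p] h_par[of x]
            arc_pverts
          by (auto simp: doubleton_eq_iff)
        \<comment> \<open>Since \<open>q\<close> lies below \<open>x\<close>, the tree path between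
          them is disjoint from the edges \<open>qq'\<close> and \<open>xp\<close>.\<close>
        show "(q, x) \<in> (parcs G - {(q, q'), (q', q), (x, p), (p, x)})\<^sup>*"
        proof (rule climb)
          fix s assume s: "(q, s) \<in> up\<^sup>*" "(s, x) \<in> up\<^sup>+"
          have "s \<in> pverts G" "s \<noteq> r"
            using tranclD[OF s(2)] by (auto simp: up_iff)
          then have "h s = Suc (h (par s))"
            by (rule h_par)
          moreover have "h x < h s" "h s \<le> h q"
            using up_trancl_h[OF s(2)] up_rtrancl_h[OF s(1)] by auto
          ultimately show "(s, par s) \<notin> {(q, q'), (q', q), (x, p), (p, x)}"
            using hq hq' p by auto
        qed (use q trancl_into_rtrancl in fast)
        show "q \<noteq> p" "x \<noteq> q'" "f x \<le> f q" "0 < f q"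
          using hq hq' p q x_pos by auto
      qed
      ultimately show False
        using p by simp
    qed
  qed
qed

lemma up_rtrancl_mono:
  assumes "(q, y) \<in> up\<^sup>*" "y \<noteq> r" "y \<noteq> a" "y \<noteq> b"
  shows "f q \<le> f y"
  using assms
proof (induction rule: converse_rtrancl_induct)
  case (step q q')
  have "q \<noteq> r" "q \<noteq> a" "q \<noteq> b"
    using up_rtrancl_triangle[OF converse_rtrancl_into_rtrancl[OF step.hyps]] step.prems by auto
  then show ?case
    using step less_par[of q] by (force simp: up_iff)
qed simp

text \<open>If \<open>v\<close> is an ancestor of \<open>par y\<close>, monotonicity along the path
  gives the claim. If \<open>y\<close> were an ancestor of \<open>par v\<close>, monotonicity would
  contradict the hypothesis on the parents. Otherwise the tree edges can be switched.\<close>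

lemma le_if_par_le:
  assumes v: "v \<in> pverts G" "v \<noteq> r" "v \<noteq> a" "v \<noteq> b" and y: "y \<in> pverts G" "y \<noteq> r" "y \<noteq> a" "y \<noteq> b"
    and "par v \<noteq> par y" "f (par y) \<le> f (par v)"
  shows "f y \<le> f v"
proof (cases "(par y, v) \<in> up\<^sup>*")
  case True
  then show ?thesis
    using up_rtrancl_mono[of "par y" v] v less_par[OF y] by simp
next
  case False
  moreover have "(par v, y) \<notin> up\<^sup>*"
    using up_rtrancl_mono[of "par v" y] y less_par[OF y] assms(10) by fastforce
  moreover have "0 < f (par v)"
    using less_par[OF v] f_nonneg[OF v(1)] by simp
  ultimately show ?thesis
    using switch_tree_edges assms by blast
qed

end

section \<open>The spiral-like ordering\<close>

text \<open>Compared in \<open>lenlex\<close>, the index sequences of the paths from the root order the vertices by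
  level, then by parent, then by index.\<close>

primrec trace :: "('a \<Rightarrow> nat) \<Rightarrow> ('a \<Rightarrow> 'a) \<Rightarrow> nat \<Rightarrow> 'a \<Rightarrow> nat list" where
  "trace idx par 0 v = [idx v]"
| "trace idx par (Suc n) v = trace idx par n (par v) @ [idx v]"

lemma length_trace: "length (trace idx par n v) = Suc n"
  by (induction n arbitrary: v) simp_all

lemma last_trace: "last (trace idx par n v) = idx v"
  by (cases n) simp_all

lemma snoc_in_lex:
  assumes "length xs = length ys" "irrefl R"
  shows "(xs @ [i], ys @ [j]) \<in> lex R \<longleftrightarrow> (xs, ys) \<in> lex R \<or> xs = ys \<and> (i, j) \<in> R"
  using assms(1) by (induction rule: list_induct2) (use assms(2) in \<open>auto simp: irrefl_def\<close>)

text \<open>Positions in a list sorted by decreasing \<open>f\<close> also break ties between equal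
  values, as a linear order requires.\<close>

lemma ex_decreasing_index:
  fixes f :: "'a \<Rightarrow> real"
  assumes "finite V"
  obtains idx :: "'a \<Rightarrow> nat" where "inj_on idx V"
    "\<And>v w. v \<in> V \<Longrightarrow> w \<in> V \<Longrightarrow> idx v < idx w \<Longrightarrow> f w \<le> f v"
proof -
  obtain xs where xs: "set xs = V" "distinct xs"
    using finite_distinct_list[OF assms] by blast
  define ys where "ys = sort_key (\<lambda>v. - f v) xs"
  have ys: "set ys = V" "distinct ys" "sorted (map (\<lambda>v. - f v) ys)"
    using xs by (simp_all add: ys_def)
  have "\<exists>i < length ys. ys ! i = v" if "v \<in> V" for v
    using that ys(1) by (metis in_set_conv_nth)
  then obtain idx where idx: "\<And>v. v \<in> V \<Longrightarrow> idx v < length ys \<and> ys ! idx v = v"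
    by metis
  show thesis
  proof (rule that)
    show "inj_on idx V"
      using idx by (metis inj_onI)
    show "f w \<le> f v" if "v \<in> V" "w \<in> V" "idx v < idx w" for v w
      using sorted_nth_mono[OF ys(3), of "idx v" "idx w"] idx[OF that(1)] idx[OF that(2)] that(3)
      by simp
  qed
qed

context bfs_tree begin

text \<open>The extra edge joins two vertices of level 1, so an arc that gains a level is a tree
  arc.\<close>

lemma level_arc:
  assumes "(u, v) \<in> parcs G" "h u + 1 = h v"
  shows "v \<noteq> r" "par v = u"
  using assms arc_cases[OF assms(1)] h_par[of u] arc_pverts[OF assms(1)] root(2) h_ab
  by (auto simp: doubleton_eq_iff)

text \<open>Induction on the level of \<open>v\<close>: the parents lie on different levels too, so
  they are distinct and their order is inherited. The triangle is the base case.\<close>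

lemma le_if_level_less:
  "v \<in> pverts G \<Longrightarrow> w \<in> pverts G \<Longrightarrow> h v < h w \<Longrightarrow> f w \<le> f v"
proof (induction "h v" arbitrary: v w rule: less_induct)
  case less
  have w: "w \<noteq> r"
    using less.prems(3) root(2) by auto
  show ?case
  proof (cases "v = r \<or> v = a \<or> v = b")
    case True
    then show ?thesis
      using root(3)[of w] off_triangle_less[of w] less.prems w h_ab by fastforce
  next
    case False
    then have v: "v \<noteq> r" "v \<noteq> a" "v \<noteq> b" by auto
    have hv: "h v = Suc (h (par v))" and hw: "h w = Suc (h (par w))"
      using h_par less.prems v w by auto
    have w': "w \<noteq> a" "w \<noteq> b"
      using hv less.prems(3) h_ab by auto
    have "f (par w) \<le> f (par v)"
      using less.hyps[of "par v" "par w"] less.prems hv hw v w par_in by simp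
    moreover have "par v \<noteq> par w"
      using hv hw less.prems(3) by auto
    ultimately show ?thesis
      using le_if_par_le less.prems(1,2) v w w' by blast
  qed
qed

lemma ex_SLO_ordering:
  assumes h: "h = hop_dist G r"
  shows "\<exists>R. SLO_ordering G r R \<and> (\<forall>u \<in> pverts G. \<forall>v \<in> pverts G. (v, u) \<in> R \<longrightarrow> f u \<le> f v)"
proof -
  obtain idx :: "'a \<Rightarrow> nat" where inj: "inj_on idx (pverts G)"
    and idx: "\<And>v w. v \<in> pverts G \<Longrightarrow> w \<in> pverts G \<Longrightarrow> idx v < idx w \<Longrightarrow> f w \<le> f v"
    using ex_decreasing_index[OF finite_pverts, of f] by blast
  define path where "path v = trace idx par (h v) v" for v
  have length_path: "length (path v) = Suc (h v)" for v
    by (simp add: path_def length_trace)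
  have inj_path: "inj_on path (pverts G)"
    using inj last_trace unfolding inj_on_def path_def by metis
  have path_snoc: "path v = path (par v) @ [idx v]" if "v \<in> pverts G" "v \<noteq> r" for v
    using h_par[OF that] by (simp add: path_def)
  define R where "R = {(v, w). v \<in> pverts G \<and> w \<in> pverts G \<and> (path v, path w) \<in> lenlex less_than}"
  have R_iff: "(v, w) \<in> R \<longleftrightarrow> v \<in> pverts G \<and> w \<in> pverts G \<and>
      (h v < h w \<or> h v = h w \<and> (path v, path w) \<in> lex less_than)" for v w
    by (auto simp: R_def lenlex_conv length_path)
  have same_level: "f w \<le> f v"
    if "v \<in> pverts G" "w \<in> pverts G" "h v = h w" "(path v, path w) \<in> lex less_than" for v w
    using that
  proof (induction "h v" arbitrary: v w rule: less_induct)
    case less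
    show ?case
    proof (cases "v = r \<or> w = r")
      case True
      have "v = r"
        using True less.prems h_par[of v] root(2) by fastforce
      then show ?thesis
        using root(3) less.prems(2) by simp
    next
      case False
      then have v: "v \<noteq> r" "h v = Suc (h (par v))" "par v \<in> pverts G"
        and w: "w \<noteq> r" "h w = Suc (h (par w))" "par w \<in> pverts G"
        using h_par par_in less.prems by auto
      have "(path (par v), path (par w)) \<in> lex less_than \<or> path (par v) = path (par w) \<and> idx v < idx w"
        using less.prems path_snoc v w
        by (simp add: snoc_in_lex length_path irrefl_def)
      then show ?thesis
      proof
        assume *: "(path (par v), path (par w)) \<in> lex less_than"
        then have "f (par w) \<le> f (par v)"
          using less.hyps[of "par v" "par w"] less.prems v w by simp
        moreover have neq: "par v \<noteq> par w"
          using * wf_lex[OF wf_less_than] by (metis wf_not_refl)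
        \<comment> \<open>\<open>le_if_par_le\<close> does not cover \<open>a\<close> and
          \<open>b\<close>. They have level 1, where all parents equal \<open>r\<close>, so distinct
          parents force a deeper level.\<close>
        moreover have "h v \<noteq> 1"
        proof
          assume "h v = 1"
          then have "h (par v) = 0" "h (par w) = 0"
            using v w less.prems(3) by auto
          then have "par v = r" "par w = r"
            using h_par[of "par v"] h_par[of "par w"] v w by auto
          then show False using neq by simp
        qed
        then have "v \<noteq> a" "v \<noteq> b" "w \<noteq> a" "w \<noteq> b"
          using h_ab less.prems(3) by auto
        ultimately show ?thesis
          using le_if_par_le less.prems(1,2) v(1) w(1) by blast
      next
        assume "path (par v) = path (par w) \<and> idx v < idx w"
        then show ?thesis
          using idx less.prems by simp
      qed
    qed
  qed
  have mono: "f w \<le> f v" if "(v, w) \<in> R" for v w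
    using that le_if_level_less same_level by (auto simp: R_iff)
  have "SLO_ordering G r R"
    unfolding SLO_ordering_def Let_def h[symmetric]
  proof (intro conjI ballI impI)
    show "R \<subseteq> pverts G \<times> pverts G"
      by (auto simp: R_def)
    have "trans R"
      unfolding R_def by (rule transI) (auto intro: lenlex_trans)
    moreover have "irrefl R"
      unfolding R_def irrefl_def by (simp add: lenlex_irreflexive)
    moreover have "total_on (pverts G) R"
    proof (rule total_onI)
      fix v w assume vw: "v \<in> pverts G" "w \<in> pverts G" "v \<noteq> w"
      then have "path v \<noteq> path w"
        using inj_path by (simp add: inj_on_eq_iff)
      then show "(v, w) \<in> R \<or> (w, v) \<in> R"
        using vw(1,2) total_lenlex[OF total_less_than] by (simp add: R_def total_on_def)
    qed
    ultimately show "strict_linear_order_on (pverts G) R"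
      by (simp add: strict_linear_order_on_def)
    have "R \<subseteq> inv_image (lenlex less_than) path"
      by (auto simp: R_def)
    then show "wf R"
      by (meson wf_inv_image wf_lenlex wf_less_than wf_subset)
    show "h v \<le> h u" if "(v, u) \<in> R" for u v
      using that by (auto simp: R_iff)
    show "(v, y) \<in> R"
      if "(u, v) \<in> parcs G \<and> (x, y) \<in> parcs G \<and> (u, y) \<notin> parcs G \<and> (x, v) \<notin> parcs G \<and>
          h u + 1 = h v \<and> h x + 1 = h y \<and> (u, x) \<in> R" for u v x y
    proof -
      \<comment> \<open>Both arcs gain a level, hence \<open>u\<close> and \<open>x\<close> are the
        parents, and the order of their paths decides the order of the extended paths.\<close>
      have v: "v \<noteq> r" "par v = u" "v \<in> pverts G" and y: "y \<noteq> r" "par y = x" "y \<in> pverts G"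
        using that level_arc arc_pverts by blast+
      then show ?thesis
        using that path_snoc[of v] path_snoc[of y]
        by (auto simp: R_iff snoc_in_lex length_path irrefl_def)
    qed
    show "u \<in> boundary_vertices G"
      if "u \<in> pverts G" "(v, u) \<in> R \<and> v \<in> boundary_vertices G" for u v
      \<comment> \<open>A boundary vertex has value 0, so by monotonicity no interior vertex, where
        \<open>f\<close> is positive, can follow it.\<close>
      using mono[of v u] that f_boundary[of v] f_interior[of u] boundary_or_interior[of u] by fastforce
  qed
  then show ?thesis
    using mono by blast
qed

end

section \<open>From the degree sequence to a tree rooted at a maximum of the eigenfunction\<close>

theorem theorem1p2:
  fixes \<pi> :: "nat list" and k :: nat
    and G :: "'a pair_pre_digraph" and f :: "'a \<Rightarrow> real"
  assumes "graphic_unicyclic \<pi>"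
    and "k < length \<pi>"
    and "3 \<le> \<pi> ! 0"
    and "\<And>i j. i \<le> j \<Longrightarrow> j \<le> k \<Longrightarrow> \<pi> ! i \<le> \<pi> ! j"
    and "\<And>i. k < i \<Longrightarrow> i < length \<pi> \<Longrightarrow> \<pi> ! i = 1"
    and "faber_krahn \<pi> G"
    and "first_eigenfunction G f"
  shows "\<exists>v0 \<in> pverts G. \<exists>R. SLO_ordering G v0 R \<and>
           (\<forall>u \<in> pverts G. \<forall>v \<in> pverts G. (v, u) \<in> R \<longrightarrow> f v \<ge> f u)"
proof -
  have uni: "pair_graph G" "connected (with_proj G)" "card (pverts G) = card (edge_set G)"
    and deg: "degree_multiset G = mset \<pi>"
    using assms(6) by (auto simp: faber_krahn_def unicyclic_class_def unicyclic_def)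
  have "finite (pverts G)"
    using uni(1) by (simp add: pair_graph_iff)
  have "out_degree (with_proj G) w = 1 \<or> 3 \<le> out_degree (with_proj G) w" if "w \<in> pverts G" for w
  proof -
    have "out_degree (with_proj G) w \<in># mset \<pi>"
      using that \<open>finite (pverts G)\<close> by (simp add: deg[symmetric] degree_multiset_def)
    then obtain i where i: "i < length \<pi>" "out_degree (with_proj G) w = \<pi> ! i"
      by (metis in_set_conv_nth set_mset_mset)
    show ?thesis
    proof (cases "i \<le> k")
      case True
      then show ?thesis
        using assms(3) assms(4)[of 0 i] i by simp
    next
      case False
      then show ?thesis
        using assms(5)[of i] i by simp
    qed
  qed
  then interpret faber_krahn_unicyclic \<pi> G f
    by unfold_locales (use assms in auto)
  have "Max (f ` pverts G) \<in> f ` pverts G"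
    using \<open>finite (pverts G)\<close> connected(1) by (intro Max_in) auto
  then obtain r where r: "r \<in> pverts G" "f r = Max (f ` pverts G)"
    by auto
  have r_max: "f v \<le> f r" if "v \<in> pverts G" for v
    using that \<open>finite (pverts G)\<close> r(2) by simp
  obtain par a b where tree:
    "\<And>v. v \<in> pverts G \<Longrightarrow> v \<noteq> r \<Longrightarrow> (v, par v) \<in> parcs G \<and> Suc (hop_dist G r (par v)) = hop_dist G r v"
    "\<And>s t. (s, t) \<in> parcs G \<Longrightarrow> s \<noteq> r \<and> par s = t \<or> t \<noteq> r \<and> par t = s \<or> {s, t} = {a, b}"
    "(a, b) \<in> parcs G" "a \<noteq> r" "b \<noteq> r" "par a \<noteq> b" "par b \<noteq> a"
    using bfs_tree_exists[OF uni(1,2) r(1) uni(3)] by blast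
  interpret bfs_tree \<pi> G f r "hop_dist G r" par a b
    by unfold_locales (fact r(1) r_max tree hop_dist_root[OF uni(1,2) r(1)])+
  show ?thesis
    using ex_SLO_ordering r(1) by blast
qed

end
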